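(* Let $X$ be a Tychonoff space and let $E$ be any set of functions with $L(X)\subseteq E\subseteq C(X_{\aleph_0})$, endowed with the topology of pointwise convergence. Then $t(E)=l^*(X_{\aleph_0})$.
   Context: All spaces are Tychonoff. A zero-set of $X$ is a set $\{x\in X: f(x)=0\}$ with $f:X\to\mathbb{R}$ continuous; $Z(X)$ is the family of all zero-sets of $X$. $X_{\aleph_0}$ is the set $X$ with the (Baire) topology having $Z(X)$ as a base. $C(X_{\aleph_0})$ is the set of all continuous real-valued functions on $X_{\aleph_0}$. $L(X)=\{n_1 f_{Z_1}+\dots+n_k f_{Z_k}: k\in\mathbb{N},\ n_i\in\mathbb{N},\ Z_i\in Z(X)\}$, where $f_Z$ is the characteristic function of $Z\subseteq X$. The topology of pointwise convergence on $E$ is the subspace topology from $\mathbb{R}^X$. $t(Y)$ is the tightness of $Y$, $l(Y)$ is the Lindelöf number of $Y$, and $l^*(Y)=\sup\{l(Y^n): n\in\mathbb{N}\}$. As is standard, values of cardinal functions are taken to be infinite cardinals (at least $\omega_0$). *)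

theory Defs
  imports "HOL-Analysis.Analysis"
begin

unbundle cardinal_syntax

section \<open>Zero-sets, the Baire topology and spaces of functions\<close>

definition zero_sets :: "'a topology \<Rightarrow> 'a set set" where
  "zero_sets X = {{x \<in> topspace X. f x = 0} | f. continuous_map X euclideanreal f}"

definition baire_topology :: "'a topology \<Rightarrow> 'a topology" where
  "baire_topology X = topology (arbitrary union_of (\<lambda>Z. Z \<in> zero_sets X))"

text \<open>Real functions on a space are represented by functions that are \<^const>\<open>undefined\<close>
  off the carrier, as in the library's \<^const>\<open>product_topology\<close>.\<close>

definition cont_funs :: "'a topology \<Rightarrow> ('a \<Rightarrow> real) set" where
  "cont_funs Y = {f \<in> extensional (topspace Y). continuous_map Y euclideanreal f}"

text \<open>Since the empty set is a zero-set, this set contains the zero function in any case, so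
  nothing depends on whether the coefficients may be \<open>0\<close> or the sum may be empty.\<close>

definition zero_set_combinations :: "'a topology \<Rightarrow> ('a \<Rightarrow> real) set" where
  "zero_set_combinations X =
    {(\<lambda>x\<in>topspace X. \<Sum>i<k. real (n i) * indicat_real (Z i) x) | (k::nat) (n :: nat \<Rightarrow> nat) Z.
       \<forall>i<k. Z i \<in> zero_sets X}"

abbreviation pointwise_topology :: "'a topology \<Rightarrow> ('a \<Rightarrow> real) set \<Rightarrow> ('a \<Rightarrow> real) topology" where
  "pointwise_topology X E \<equiv> subtopology (powertop_real (topspace X)) E"


section \<open>Cardinal functions\<close>

text \<open>Cardinals are cardinal orders in the sense of the library, compared across types by
  \<open>\<le>o\<close> and \<open>=o\<close>. The least infinite cardinal with a property is therefore determined up to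
  \<open>=o\<close> only, and it is taken on a fixed type. For each of the cardinal functions below that type
  is large enough: the lemmas following the definitions characterize their values by comparison
  with infinite cardinals on arbitrary types.\<close>

definition least_inf_card :: "('k rel \<Rightarrow> bool) \<Rightarrow> 'k rel" where
  "least_inf_card P =
    (SOME \<kappa>. Cinfinite \<kappa> \<and> P \<kappa> \<and> (\<forall>\<mu>. Cinfinite \<mu> \<and> P \<mu> \<longrightarrow> \<kappa> \<le>o \<mu>))"

definition tightness_le :: "'b topology \<Rightarrow> 'k rel \<Rightarrow> bool" where
  "tightness_le Y \<kappa> \<longleftrightarrow>
    (\<forall>A x. A \<subseteq> topspace Y \<and> x \<in> Y closure_of A \<longrightarrow>
      (\<exists>B. B \<subseteq> A \<and> |B| \<le>o \<kappa> \<and> x \<in> Y closure_of B))"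

definition tightness :: "'b topology \<Rightarrow> ('b + nat) rel" where
  "tightness Y = least_inf_card (tightness_le Y)"

definition lindelof_le :: "'b topology \<Rightarrow> 'k rel \<Rightarrow> bool" where
  "lindelof_le Y \<kappa> \<longleftrightarrow>
    (\<forall>\<U>. (\<forall>U\<in>\<U>. openin Y U) \<and> \<Union>\<U> = topspace Y \<longrightarrow>
      (\<exists>\<V>. \<V> \<subseteq> \<U> \<and> |\<V>| \<le>o \<kappa> \<and> \<Union>\<V> = topspace Y))"

definition lindelof_number :: "'b topology \<Rightarrow> ('b + nat) rel" where
  "lindelof_number Y = least_inf_card (lindelof_le Y)"

abbreviation finite_power :: "'b topology \<Rightarrow> nat \<Rightarrow> (nat \<Rightarrow> 'b) topology" where
  "finite_power Y n \<equiv> product_topology (\<lambda>_. Y) {..<n}"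

text \<open>The supremum of the Lindeloef numbers of the finite powers is their least upper bound.\<close>

definition lindelof_star :: "'b topology \<Rightarrow> ((nat \<Rightarrow> 'b) + nat) rel" where
  "lindelof_star Y = least_inf_card (\<lambda>\<kappa>. \<forall>n\<ge>1. lindelof_number (finite_power Y n) \<le>o \<kappa>)"


section \<open>Adequacy of the definitions\<close>

lemma zero_sets_Int:
  assumes "S \<in> zero_sets X" "T \<in> zero_sets X"
  shows "S \<inter> T \<in> zero_sets X"
proof -
  obtain f g where f: "continuous_map X euclideanreal f" "S = {x \<in> topspace X. f x = 0}"
    and g: "continuous_map X euclideanreal g" "T = {x \<in> topspace X. g x = 0}"
    using assms by (auto simp: zero_sets_def)
  have "continuous_map X euclideanreal (\<lambda>x. \<bar>f x\<bar> + \<bar>g x\<bar>)"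
    using f(1) g(1) by (intro continuous_map_add continuous_map_real_abs)
  moreover have "S \<inter> T = {x \<in> topspace X. \<bar>f x\<bar> + \<bar>g x\<bar> = 0}"
    using f(2) g(2) by auto
  ultimately show ?thesis
    unfolding zero_sets_def mem_Collect_eq by (intro exI conjI)
qed

lemma openin_baire_topology:
  "openin (baire_topology X) U \<longleftrightarrow> (\<exists>\<Z> \<subseteq> zero_sets X. U = \<Union>\<Z>)"
proof -
  have "istopology (arbitrary union_of (\<lambda>Z. Z \<in> zero_sets X))"
    by (rule istopology_base) (rule zero_sets_Int)
  then have "openin (baire_topology X) U \<longleftrightarrow> (arbitrary union_of (\<lambda>Z. Z \<in> zero_sets X)) U"
    by (simp add: baire_topology_def topology_inverse')
  then show ?thesis
    by (auto simp: union_of_def arbitrary_def subset_iff)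
qed

lemma topspace_baire_topology [simp]: "topspace (baire_topology X) = topspace X"
proof -
  have "topspace X \<in> zero_sets X"
    unfolding zero_sets_def by (auto intro!: exI[of _ "\<lambda>_. 0"])
  then have "openin (baire_topology X) (topspace X)"
    unfolding openin_baire_topology by (intro exI[of _ "{topspace X}"]) auto
  moreover have "U \<subseteq> topspace X" if "openin (baire_topology X) U" for U
    using that unfolding openin_baire_topology zero_sets_def by blast
  ultimately show ?thesis
    by (metis openin_subset openin_topspace subset_antisym)
qed

lemma least_inf_card:
  assumes "Cinfinite \<kappa>" "P \<kappa>"
  shows "Cinfinite (least_inf_card P)" "P (least_inf_card P)"
    and "\<And>\<mu>. Cinfinite \<mu> \<Longrightarrow> P \<mu> \<Longrightarrow> least_inf_card P \<le>o \<mu>"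
proof -
  have "\<exists>r\<in>{r. Cinfinite r \<and> P r}. \<forall>r'\<in>{r. Cinfinite r \<and> P r}. r \<le>o r'"
    using assms by (intro exists_minim_Card_order) auto
  then have "\<exists>r. Cinfinite r \<and> P r \<and> (\<forall>\<mu>. Cinfinite \<mu> \<and> P \<mu> \<longrightarrow> r \<le>o \<mu>)"
    by blast
  from someI_ex[OF this]
  have *: "Cinfinite (least_inf_card P) \<and> P (least_inf_card P) \<and>
      (\<forall>\<mu>. Cinfinite \<mu> \<and> P \<mu> \<longrightarrow> least_inf_card P \<le>o \<mu>)"
    unfolding least_inf_card_def .
  show "Cinfinite (least_inf_card P)" "P (least_inf_card P)"
    by (rule *[THEN conjunct1], rule *[THEN conjunct2, THEN conjunct1])
  show "least_inf_card P \<le>o \<mu>" if "Cinfinite \<mu>" "P \<mu>" for \<mu>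
    using *[THEN conjunct2, THEN conjunct2, rule_format, OF conjI, OF that] .
qed

lemma least_inf_card_ordLeq:
  fixes \<kappa> :: "'l rel" and P :: "'k rel \<Rightarrow> bool"
  assumes wit: "Cinfinite \<kappa>\<^sub>0" "P \<kappa>\<^sub>0" and \<kappa>: "Cinfinite \<kappa>"
    and transfer: "\<And>\<mu>. Cinfinite \<mu> \<Longrightarrow> \<mu> =o \<kappa> \<Longrightarrow> P \<mu>"
  shows "least_inf_card P \<le>o \<kappa>"
proof (rule ccontr)
  let ?l = "least_inf_card P"
  have l: "Cinfinite ?l" and least: "\<And>\<mu>. Cinfinite \<mu> \<Longrightarrow> P \<mu> \<Longrightarrow> ?l \<le>o \<mu>"
    using least_inf_card[of \<kappa>\<^sub>0 P, OF wit] by - assumption+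
  assume "\<not> ?l \<le>o \<kappa>"
  then have "\<kappa> \<le>o ?l"
    using ordLeq_total[of ?l \<kappa>] l \<kappa> by (auto simp: card_order_on_def)
  then have "|Field \<kappa>| \<le>o |Field ?l|"
    by (rule card_of_mono2)
  then have "\<exists>f. inj_on f (Field \<kappa>) \<and> f ` Field \<kappa> \<subseteq> Field ?l"
    unfolding card_of_ordLeq .
  then obtain f :: "'l \<Rightarrow> 'k" where f: "inj_on f (Field \<kappa>)"
    by blast
  have "|f ` Field \<kappa>| =o |Field \<kappa>|"
    using card_of_ordIsoI[OF inj_on_imp_bij_betw[OF f]] by (rule ordIso_symmetric)
  then have eq: "|f ` Field \<kappa>| =o \<kappa>"
    using card_of_Field_ordIso[OF conjunct2[OF \<kappa>]] by (rule ordIso_transitive)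
  then have inf: "Cinfinite |f ` Field \<kappa>|"
    using Cinfinite_cong[OF ordIso_symmetric \<kappa>] by blast
  have "?l \<le>o |f ` Field \<kappa>|"
    by (rule least[OF inf transfer[OF inf eq]])
  then have "?l \<le>o \<kappa>"
    using eq by (rule ordLeq_ordIso_trans)
  with \<open>\<not> ?l \<le>o \<kappa>\<close> show False ..
qed

lemma Cinfinite_UNIV_sum_nat: "Cinfinite |UNIV :: ('b + nat) set|"
  unfolding cinfinite_def using card_of_Card_order[of "UNIV :: ('b + nat) set"]
  by (simp add: Field_card_of finite_Plus_UNIV_iff)

lemma card_of_ordLeq_UNIV_sum_nat: "|A :: 'b set| \<le>o |UNIV :: ('b + nat) set|"
  unfolding card_of_ordLeq[symmetric] by (intro exI[of _ Inl]) simp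

lemma tightness_le_mono: "tightness_le Y \<kappa> \<Longrightarrow> \<kappa> \<le>o \<mu> \<Longrightarrow> tightness_le Y \<mu>"
  unfolding tightness_le_def by (elim all_forward imp_forward ex_forward conj_forward)
    (auto intro: ordLeq_transitive)

lemma lindelof_le_mono: "lindelof_le Y \<kappa> \<Longrightarrow> \<kappa> \<le>o \<mu> \<Longrightarrow> lindelof_le Y \<mu>"
  unfolding lindelof_le_def by (elim all_forward imp_forward ex_forward conj_forward)
    (auto intro: ordLeq_transitive)

lemma tightness_le_UNIV: "tightness_le Y |UNIV :: ('b + nat) set|" for Y :: "'b topology"
  unfolding tightness_le_def
  by (intro allI impI, elim conjE, rule exI, intro conjI, rule order_refl)
    (rule card_of_ordLeq_UNIV_sum_nat)

lemma lindelof_le_UNIV: "lindelof_le Y |UNIV :: ('b + nat) set|" for Y :: "'b topology"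
  unfolding lindelof_le_def
proof (intro allI impI, elim conjE)
  fix \<U> assume "\<Union>\<U> = topspace Y"
  then have "\<forall>y\<in>topspace Y. \<exists>U. U \<in> \<U> \<and> y \<in> U"
    by blast
  then obtain c :: "'b \<Rightarrow> 'b set" where c: "\<forall>y\<in>topspace Y. c y \<in> \<U> \<and> y \<in> c y"
    by (rule bchoice[THEN exE])
  have "|c ` topspace Y| \<le>o |UNIV :: ('b + nat) set|"
    by (rule ordLeq_transitive[OF card_of_image card_of_ordLeq_UNIV_sum_nat])
  moreover have "\<Union>(c ` topspace Y) = topspace Y" "c ` topspace Y \<subseteq> \<U>"
    using c \<open>\<Union>\<U> = topspace Y\<close> by blast+
  ultimately show "\<exists>\<V>. \<V> \<subseteq> \<U> \<and> |\<V>| \<le>o |UNIV :: ('b + nat) set| \<and> \<Union>\<V> = topspace Y"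
    by blast
qed

lemma Cinfinite_tightness: "Cinfinite (tightness Y)"
  unfolding tightness_def
  by (rule least_inf_card(1)[of _ "tightness_le Y", OF Cinfinite_UNIV_sum_nat tightness_le_UNIV])

lemma tightness_ordLeq_iff:
  assumes "Cinfinite \<kappa>"
  shows "tightness Y \<le>o \<kappa> \<longleftrightarrow> tightness_le Y \<kappa>"
proof
  have "tightness_le Y (tightness Y)"
    unfolding tightness_def
    by (rule least_inf_card(2)[of _ "tightness_le Y", OF Cinfinite_UNIV_sum_nat tightness_le_UNIV])
  then show "tightness Y \<le>o \<kappa> \<Longrightarrow> tightness_le Y \<kappa>"
    by (rule tightness_le_mono)
next
  assume "tightness_le Y \<kappa>"
  then show "tightness Y \<le>o \<kappa>"
    unfolding tightness_def
    by (intro least_inf_card_ordLeq[of _ "tightness_le Y", OF Cinfinite_UNIV_sum_nat tightness_le_UNIV assms])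
      (rule tightness_le_mono[OF _ ordIso_imp_ordLeq[OF ordIso_symmetric]])
qed

lemma Cinfinite_lindelof_number: "Cinfinite (lindelof_number Y)"
  unfolding lindelof_number_def
  by (rule least_inf_card(1)[of _ "lindelof_le Y", OF Cinfinite_UNIV_sum_nat lindelof_le_UNIV])

lemma lindelof_number_ordLeq_iff:
  assumes "Cinfinite \<kappa>"
  shows "lindelof_number Y \<le>o \<kappa> \<longleftrightarrow> lindelof_le Y \<kappa>"
proof
  have "lindelof_le Y (lindelof_number Y)"
    unfolding lindelof_number_def
    by (rule least_inf_card(2)[of _ "lindelof_le Y", OF Cinfinite_UNIV_sum_nat lindelof_le_UNIV])
  then show "lindelof_number Y \<le>o \<kappa> \<Longrightarrow> lindelof_le Y \<kappa>"
    by (rule lindelof_le_mono)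
next
  assume "lindelof_le Y \<kappa>"
  then show "lindelof_number Y \<le>o \<kappa>"
    unfolding lindelof_number_def
    by (intro least_inf_card_ordLeq[of _ "lindelof_le Y", OF Cinfinite_UNIV_sum_nat lindelof_le_UNIV assms])
      (rule lindelof_le_mono[OF _ ordIso_imp_ordLeq[OF ordIso_symmetric]])
qed

lemma lindelof_star_bounded:
  "\<forall>n\<ge>1. lindelof_number (finite_power Y n) \<le>o |UNIV :: ((nat \<Rightarrow> 'b) + nat) set|"
  for Y :: "'b topology"
  unfolding lindelof_number_ordLeq_iff[OF Cinfinite_UNIV_sum_nat] by (intro allI impI lindelof_le_UNIV)

lemma Cinfinite_lindelof_star: "Cinfinite (lindelof_star Y)"
  unfolding lindelof_star_def
  by (rule least_inf_card(1)[of _ "\<lambda>\<kappa>. \<forall>n\<ge>1. lindelof_number (finite_power Y n) \<le>o \<kappa>",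
        OF Cinfinite_UNIV_sum_nat lindelof_star_bounded])

lemma lindelof_star_ordLeq_iff:
  assumes "Cinfinite \<kappa>"
  shows "lindelof_star Y \<le>o \<kappa> \<longleftrightarrow> (\<forall>n\<ge>1. lindelof_number (finite_power Y n) \<le>o \<kappa>)"
proof
  have "\<forall>n\<ge>1. lindelof_number (finite_power Y n) \<le>o lindelof_star Y"
    unfolding lindelof_star_def
    by (rule least_inf_card(2)[of _ "\<lambda>\<kappa>. \<forall>n\<ge>1. lindelof_number (finite_power Y n) \<le>o \<kappa>",
          OF Cinfinite_UNIV_sum_nat lindelof_star_bounded])
  then show "lindelof_star Y \<le>o \<kappa> \<Longrightarrow> \<forall>n\<ge>1. lindelof_number (finite_power Y n) \<le>o \<kappa>"
    using ordLeq_transitive by blast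
next
  assume "\<forall>n\<ge>1. lindelof_number (finite_power Y n) \<le>o \<kappa>"
  then show "lindelof_star Y \<le>o \<kappa>"
    unfolding lindelof_star_def
    by (intro least_inf_card_ordLeq[of _ "\<lambda>\<kappa>. \<forall>n\<ge>1. lindelof_number (finite_power Y n) \<le>o \<kappa>",
          OF Cinfinite_UNIV_sum_nat lindelof_star_bounded assms])
      (blast intro: ordLeq_ordIso_trans ordIso_symmetric)
qed

end

theory Submission
  imports Defs
begin

text \<open>
  Write \<open>Y\<close> for \<open>X\<close> with the Baire topology. Both sides of the equation are least infinite cardinals,
  so it suffices to show that an infinite cardinal \<open>\<kappa>\<close> bounds the tightness of \<open>E\<close> if and only if every
  open cover of every power \<open>Y\<^sup>n\<close> with \<open>n \<ge> 1\<close> has a subcover of size at most \<open>\<kappa>\<close>. The argument is that of the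
  Arhangel'skii--Pytkeev theorem \<open>t (C\<^sub>p Y) = l\<^sup>* Y\<close>; the point is that its only use of a rich supply of
  continuous functions can be served by characteristic functions of zero-sets.

  From Lindeloef to tightness (lemma \<open>tightness_le_if_lindelof_le_power\<close>): let \<open>f\<close> lie in the closure of
  \<open>A\<close>. For each \<open>n\<close> the sets of all \<open>p \<in> Y\<^sup>n\<close> with \<open>\<bar>g (p i) - f (p i)\<bar> < 1/n\<close> for all \<open>i < n\<close>, with \<open>g\<close>
  ranging over \<open>A\<close>, form an open cover of \<open>Y\<^sup>n\<close>, because \<open>f\<close> can be approximated by members of \<open>A\<close> on every
  finite set. A subcover of size at most \<open>\<kappa>\<close> picks out at most \<open>\<kappa>\<close> functions \<open>g\<close>. Those chosen for all
  \<open>n\<close> together still approximate \<open>f\<close>, since \<open>n\<close> can be taken large enough both to list a given finite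
  set and to make \<open>1/n\<close> small.

  From tightness to Lindeloef (lemma \<open>lindelof_le_power_if_tightness_le\<close>): given an open cover \<open>\<U>\<close> of
  \<open>Y\<^sup>n\<close>, call a zero-set \<open>Z\<close> small if \<open>Z\<^sup>n\<close> is covered by finitely many members of \<open>\<U>\<close>. Every finite set
  is contained in a small zero-set (lemma \<open>finite_set_cube_tube\<close>), because zero-sets are a base of \<open>Y\<close>
  and are closed under finite unions and intersections. Hence the constant function \<open>1\<close> is in the
  closure of the characteristic functions of small zero-sets, all of which belong to \<open>E\<close>, and by
  tightness it is in the closure of at most \<open>\<kappa>\<close> of them. As these functions only take the values \<open>0\<close> and \<open>1\<close>,
  approximating \<open>1\<close> at the coordinates of \<open>p \<in> Y\<^sup>n\<close> with error less than \<open>1\<close> forces \<open>p \<in> Z\<^sup>n\<close> for one of the chosen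
  \<open>Z\<close>; so the finite subfamilies belonging to the chosen \<open>Z\<close> together cover \<open>Y\<^sup>n\<close>.
\<close>

section \<open>The lattice of zero-sets\<close>

lemma zero_sets_Un:
  assumes "S \<in> zero_sets X" "T \<in> zero_sets X"
  shows "S \<union> T \<in> zero_sets X"
proof -
  obtain f g where f: "continuous_map X euclideanreal f" "S = {x \<in> topspace X. f x = 0}"
    and g: "continuous_map X euclideanreal g" "T = {x \<in> topspace X. g x = 0}"
    using assms by (auto simp: zero_sets_def)
  have "continuous_map X euclideanreal (\<lambda>x. f x * g x)"
    using f(1) g(1) by (rule continuous_map_real_mult)
  moreover have "S \<union> T = {x \<in> topspace X. f x * g x = 0}"
    using f(2) g(2) by auto
  ultimately show ?thesis
    unfolding zero_sets_def mem_Collect_eq by (intro exI conjI)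
qed

lemma topspace_in_zero_sets: "topspace X \<in> zero_sets X"
  unfolding zero_sets_def by (auto intro!: exI[of _ "\<lambda>_. 0"])

lemma empty_in_zero_sets: "{} \<in> zero_sets X"
  unfolding zero_sets_def by (auto intro!: exI[of _ "\<lambda>_. 1"])

lemma zero_sets_UN:
  assumes "finite I" "\<And>i. i \<in> I \<Longrightarrow> S i \<in> zero_sets X"
  shows "(\<Union>i\<in>I. S i) \<in> zero_sets X"
  using assms by (induction I) (auto intro: zero_sets_Un empty_in_zero_sets)

lemma zero_sets_INT:
  assumes "finite I" "\<And>i. i \<in> I \<Longrightarrow> S i \<in> zero_sets X"
  shows "topspace X \<inter> (\<Inter>i\<in>I. S i) \<in> zero_sets X"
  using assms
proof (induction I)
  case empty
  show ?case
    by (simp add: topspace_in_zero_sets)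
next
  case (insert i I)
  then have "S i \<inter> (topspace X \<inter> (\<Inter>j\<in>I. S j)) \<in> zero_sets X"
    by (intro zero_sets_Int[of "S i" X]) auto
  also have "S i \<inter> (topspace X \<inter> (\<Inter>j\<in>I. S j)) = topspace X \<inter> (\<Inter>j\<in>insert i I. S j)"
    by auto
  finally show ?case .
qed

lemma openin_baire_topology_imp_zero_set:
  assumes "openin (baire_topology X) U" "x \<in> U"
  obtains Z where "Z \<in> zero_sets X" "x \<in> Z" "Z \<subseteq> U"
  using assms unfolding openin_baire_topology by blast

lemma indicator_zero_set_in_combinations:
  assumes "Z \<in> zero_sets X"
  shows "(\<lambda>x\<in>topspace X. indicat_real Z x) \<in> zero_set_combinations X"
  unfolding zero_set_combinations_def using assms
  by (intro CollectI exI[of _ "1::nat"] exI[of _ "\<lambda>_. 1::nat"] exI[of _ "\<lambda>_. Z"])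
    (simp add: lessThan_Suc)

section \<open>Closures in the topology of pointwise convergence\<close>

text \<open>The real-valued form of the product topology used by both halves of the theorem: only finitely many points
  matter, and one tolerance serves for all of them.\<close>

lemma in_closure_of_pointwise_topology:
  assumes "E \<subseteq> extensional (topspace X)" "A \<subseteq> E" "f \<in> E"
  shows "f \<in> pointwise_topology X E closure_of A \<longleftrightarrow>
    (\<forall>K \<epsilon>. finite K \<and> K \<subseteq> topspace X \<and> 0 < \<epsilon> \<longrightarrow> (\<exists>g\<in>A. \<forall>x\<in>K. \<bar>g x - f x\<bar> < \<epsilon>))"
    (is "_ \<longleftrightarrow> ?approx")
proof -
  let ?P = "powertop_real (topspace X)"
  have ext: "g \<in> topspace ?P" if "g \<in> E" for g
    using that assms(1) by (auto simp: PiE_def)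
  have "f \<in> pointwise_topology X E closure_of A \<longleftrightarrow> f \<in> ?P closure_of A"
    using assms(2,3) by (simp add: closure_of_subtopology inf_absorb2)
  also have "\<dots> \<longleftrightarrow> ?approx"
  proof
    assume cl: "f \<in> ?P closure_of A"
    show ?approx
    proof (intro allI impI, elim conjE)
      fix K and \<epsilon> :: real
      assume K: "finite K" "K \<subseteq> topspace X" and "0 < \<epsilon>"
      define W where "W = (\<Pi>\<^sub>E x\<in>topspace X. if x \<in> K then ball (f x) \<epsilon> else UNIV)"
      have "openin ?P W"
        unfolding W_def
        by (rule product_topology_basis) (use K in \<open>auto intro: finite_subset[of _ K]\<close>)
      moreover have "f \<in> W"
        using ext[OF assms(3)] \<open>0 < \<epsilon>\<close> by (auto simp: W_def PiE_iff)
      ultimately obtain g where "g \<in> A" "g \<in> W"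
        using cl unfolding in_closure_of by blast
      have "\<bar>g x - f x\<bar> < \<epsilon>" if "x \<in> K" for x
      proof -
        have "g x \<in> (if x \<in> K then ball (f x) \<epsilon> else UNIV)"
          using \<open>g \<in> W\<close> that K(2) unfolding W_def by blast
        then show ?thesis
          using that by (simp add: dist_real_def abs_minus_commute)
      qed
      then show "\<exists>g\<in>A. \<forall>x\<in>K. \<bar>g x - f x\<bar> < \<epsilon>"
        using \<open>g \<in> A\<close> by blast
    qed
  next
    assume approx: ?approx
    show "f \<in> ?P closure_of A"
      unfolding in_closure_of
    proof (intro conjI allI impI ext[OF assms(3)], elim conjE)
      fix T
      assume "f \<in> T" "openin ?P T"
      then obtain U where U: "finite {x \<in> topspace X. U x \<noteq> UNIV}" "\<And>x. x \<in> topspace X \<Longrightarrow> open (U x)"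
        "f \<in> Pi\<^sub>E (topspace X) U" "Pi\<^sub>E (topspace X) U \<subseteq> T"
        unfolding openin_product_topology_alt by auto
      define K where "K = {x \<in> topspace X. U x \<noteq> UNIV}"
      have "\<exists>e>0. ball (f x) e \<subseteq> U x" if "x \<in> K" for x
        using U(2)[of x] U(3) that unfolding K_def open_contains_ball by auto
      then obtain e where e: "\<And>x. x \<in> K \<Longrightarrow> 0 < e x \<and> ball (f x) (e x) \<subseteq> U x"
        by metis
      define \<epsilon> where "\<epsilon> = Min (insert 1 (e ` K))"
      have "finite K"
        using U(1) by (simp add: K_def)
      then have "0 < \<epsilon>" and le: "\<And>x. x \<in> K \<Longrightarrow> \<epsilon> \<le> e x"
        using e by (auto simp: \<epsilon>_def)
      then obtain g where g: "g \<in> A" "\<forall>x\<in>K. \<bar>g x - f x\<bar> < \<epsilon>"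
        using approx \<open>finite K\<close> unfolding K_def by blast
      have "g x \<in> U x" if "x \<in> topspace X" for x
      proof (cases "x \<in> K")
        case True
        then have "g x \<in> ball (f x) (e x)"
          using g(2) le[OF True] by (fastforce simp: dist_real_def abs_minus_commute)
        then show ?thesis
          using e True by blast
      qed (use that in \<open>auto simp: K_def\<close>)
      then have "g \<in> Pi\<^sub>E (topspace X) U"
        using ext[of g] g(1) assms(2) by (auto simp: PiE_iff)
      then show "\<exists>g. g \<in> A \<and> g \<in> T"
        using U(4) g(1) by blast
    qed
  qed
  finally show ?thesis .
qed

section \<open>Small zero-sets around finite sets\<close>

text \<open>A tube lemma for powers of a finite, hence compact, set. Each point \<open>p\<close> of \<open>K\<^sup>n\<close> has a box of
  zero-sets inside a member of the cover. Intersecting, for fixed \<open>x \<in> K\<close>, all sides of these boxes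
  that sit at a coordinate where \<open>p\<close> takes the value \<open>x\<close> gives one neighbourhood \<open>V x\<close> that fits
  into every box in which \<open>x\<close> occurs. The \<open>n\<close>-th power of the union of the \<open>V x\<close> is then contained in the union of
  the finitely many boxes.\<close>

lemma finite_set_cube_tube:
  assumes cover: "\<And>U. U \<in> \<U> \<Longrightarrow> openin (finite_power (baire_topology X) n) U"
      "topspace (finite_power (baire_topology X) n) \<subseteq> \<Union>\<U>"
    and K: "finite K" "K \<subseteq> topspace X"
  obtains Z \<F> where "Z \<in> zero_sets X" "K \<subseteq> Z" "finite \<F>" "\<F> \<subseteq> \<U>"
    "(\<Pi>\<^sub>E i\<in>{..<n}. Z) \<subseteq> \<Union>\<F>"
proof -
  let ?C = "\<Pi>\<^sub>E i\<in>{..<n}. K"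
  have "\<exists>U W. U \<in> \<U> \<and> (\<forall>i<n. W i \<in> zero_sets X \<and> p i \<in> W i) \<and> Pi\<^sub>E {..<n} W \<subseteq> U"
    if p: "p \<in> ?C" for p
  proof -
    have "p \<in> topspace (finite_power (baire_topology X) n)"
      using p K(2) by (auto simp: PiE_iff)
    then obtain U where U: "U \<in> \<U>" "p \<in> U"
      using cover(2) by blast
    then obtain T where T: "\<And>i. i < n \<Longrightarrow> openin (baire_topology X) (T i)"
      "p \<in> Pi\<^sub>E {..<n} T" "Pi\<^sub>E {..<n} T \<subseteq> U"
      using cover(1)[OF U(1)] U(2) unfolding openin_product_topology_alt by (metis lessThan_iff)
    then have "\<exists>Z. Z \<in> zero_sets X \<and> p i \<in> Z \<and> Z \<subseteq> T i" if "i < n" for i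
      by (metis that openin_baire_topology_imp_zero_set PiE_mem lessThan_iff)
    then obtain W where W: "\<And>i. i < n \<Longrightarrow> W i \<in> zero_sets X \<and> p i \<in> W i \<and> W i \<subseteq> T i"
      by metis
    then have "Pi\<^sub>E {..<n} W \<subseteq> U"
      using PiE_mono[of "{..<n}" W T] T(3) by auto
    with U(1) W show ?thesis
      by blast
  qed
  then obtain U W where UW: "\<And>p. p \<in> ?C \<Longrightarrow> U p \<in> \<U>"
      "\<And>p i. p \<in> ?C \<Longrightarrow> i < n \<Longrightarrow> W p i \<in> zero_sets X \<and> p i \<in> W p i"
      "\<And>p. p \<in> ?C \<Longrightarrow> Pi\<^sub>E {..<n} (W p) \<subseteq> U p"
    by metis
  have finC: "finite ?C"
    using K(1) by (intro finite_PiE) auto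
  \<comment> \<open>If \<open>n = 0\<close>, then \<open>J x\<close> is empty; intersecting with the whole space keeps \<open>V x\<close> a zero-set.\<close>
  define J where "J x = {(p, i). p \<in> ?C \<and> i < n \<and> p i = x}" for x
  define V where "V x = topspace X \<inter> (\<Inter>(p, i)\<in>J x. W p i)" for x
  have "finite (J x)" for x
    by (rule finite_subset[of _ "?C \<times> {..<n}"]) (use finC in \<open>auto simp: J_def\<close>)
  then have V: "V x \<in> zero_sets X" for x
    unfolding V_def using UW(2) by (intro zero_sets_INT) (auto simp: J_def)
  show ?thesis
  proof
    show "(\<Union>x\<in>K. V x) \<in> zero_sets X"
      using K(1) V by (rule zero_sets_UN)
    show "K \<subseteq> (\<Union>x\<in>K. V x)"
      using K(2) UW(2) by (auto simp: V_def J_def)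
    show "finite (U ` ?C)"
      using finC by simp
    show "U ` ?C \<subseteq> \<U>"
      using UW(1) by auto
    show "(\<Pi>\<^sub>E i\<in>{..<n}. \<Union>x\<in>K. V x) \<subseteq> \<Union>(U ` ?C)"
    proof
      fix q
      assume q: "q \<in> (\<Pi>\<^sub>E i\<in>{..<n}. \<Union>x\<in>K. V x)"
      then have "\<forall>i<n. \<exists>x. x \<in> K \<and> q i \<in> V x"
        by (auto simp: PiE_iff)
      \<comment> \<open>Reading off which \<open>V x\<close> contains each coordinate of \<open>q\<close> gives the centre \<open>p \<in> K\<^sup>n\<close> of the box
        that contains \<open>q\<close>.\<close>
      then obtain c where c: "\<And>i. i < n \<Longrightarrow> c i \<in> K \<and> q i \<in> V (c i)"
        by metis
      define p where "p = restrict c {..<n}"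
      have p: "p \<in> ?C"
        using c by (auto simp: p_def)
      have "q i \<in> W p i" if "i < n" for i
        using c[OF that] p that by (auto simp: V_def J_def p_def)
      then have "q \<in> Pi\<^sub>E {..<n} (W p)"
        using q by (auto simp: PiE_iff)
      then show "q \<in> \<Union>(U ` ?C)"
        using UW(3)[OF p] p by blast
    qed
  qed
qed

section \<open>Bounding the Lindeloef number of the powers by the tightness\<close>

lemma finite_card_of_ordLeq_Cinfinite:
  assumes "Cinfinite \<kappa>" "finite A"
  shows "|A| \<le>o \<kappa>"
proof -
  have "|A| <o natLeq"
    using assms(2) by (simp add: finite_iff_ordLess_natLeq)
  also have "natLeq \<le>o \<kappa>"
    using assms(1) by (rule natLeq_ordLeq_cinfinite)
  finally show ?thesis
    by (rule ordLess_imp_ordLeq)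
qed

lemma subset_image_card_ordLeq:
  assumes "B \<subseteq> h ` S" "|B| \<le>o \<kappa>"
  obtains C where "C \<subseteq> S" "|C| \<le>o \<kappa>" "B = h ` C"
proof -
  obtain C where C: "C \<subseteq> S" "inj_on h C" "B = h ` C"
    using assms(1) by (metis subset_image_inj)
  then have "|C| =o |B|"
    by (intro card_of_ordIsoI[of h]) (simp add: bij_betw_def)
  then have "|C| \<le>o \<kappa>"
    using assms(2) by (rule ordIso_ordLeq_trans)
  with C that show ?thesis
    by blast
qed

text \<open>Tightness is used at a single point, the constant function \<open>1\<close>, and only for a set of
  characteristic functions of zero-sets. Only finitely many members of the cover are chosen for
  each of these zero-sets, so the subcover is no larger than \<open>\<kappa>\<close>.\<close>

lemma lindelof_le_power_if_tightness_le:
  assumes \<kappa>: "Cinfinite \<kappa>" and tight: "tightness_le (pointwise_topology X E) \<kappa>"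
    and E: "zero_set_combinations X \<subseteq> E" "E \<subseteq> extensional (topspace X)"
  shows "lindelof_le (finite_power (baire_topology X) n) \<kappa>"
  unfolding lindelof_le_def
proof (intro allI impI, elim conjE)
  let ?Yn = "finite_power (baire_topology X) n"
  define ind where "ind Z = (\<lambda>x\<in>topspace X. indicat_real Z x)" for Z
  have ind: "ind Z x = (if x \<in> Z then 1 else 0)" if "x \<in> topspace X" for Z x
    using that by (simp add: ind_def indicator_def)
  fix \<U>
  assume "\<forall>U\<in>\<U>. openin ?Yn U" and un: "\<Union>\<U> = topspace ?Yn"
  then have op: "\<And>U. U \<in> \<U> \<Longrightarrow> openin ?Yn U" and cov: "topspace ?Yn \<subseteq> \<Union>\<U>"
    by auto
  define \<S> where "\<S> = {Z \<in> zero_sets X. \<exists>\<F>. finite \<F> \<and> \<F> \<subseteq> \<U> \<and> (\<Pi>\<^sub>E i\<in>{..<n}. Z) \<subseteq> \<Union>\<F>}"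
  have indE: "ind Z \<in> E" if "Z \<in> zero_sets X" for Z
    using indicator_zero_set_in_combinations[OF that] E(1) by (auto simp: ind_def)
  then have SE: "ind ` \<S> \<subseteq> E"
    by (auto simp: \<S>_def)
  have one: "ind (topspace X) \<in> E"
    by (intro indE topspace_in_zero_sets)
  note cl = in_closure_of_pointwise_topology[OF E(2) _ one]
  have "ind (topspace X) \<in> pointwise_topology X E closure_of (ind ` \<S>)"
    unfolding cl[OF SE]
  proof (intro allI impI, elim conjE)
    fix K and \<epsilon> :: real
    assume K: "finite K" "K \<subseteq> topspace X" and "0 < \<epsilon>"
    obtain Z \<F> where Z: "Z \<in> zero_sets X" "K \<subseteq> Z" "finite \<F>" "\<F> \<subseteq> \<U>"
      "(\<Pi>\<^sub>E i\<in>{..<n}. Z) \<subseteq> \<Union>\<F>"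
      using finite_set_cube_tube[OF op cov K] by blast
    have "\<bar>ind Z x - ind (topspace X) x\<bar> < \<epsilon>" if "x \<in> K" for x
      using that Z(2) K(2) \<open>0 < \<epsilon>\<close> by (simp add: ind subset_iff)
    moreover have "Z \<in> \<S>"
      using Z by (auto simp: \<S>_def)
    ultimately show "\<exists>g\<in>ind ` \<S>. \<forall>x\<in>K. \<bar>g x - ind (topspace X) x\<bar> < \<epsilon>"
      by blast
  qed
  moreover have "ind ` \<S> \<subseteq> topspace (pointwise_topology X E)"
    using SE E(2) by (auto simp: PiE_def)
  ultimately obtain B where B: "B \<subseteq> ind ` \<S>" "|B| \<le>o \<kappa>"
      "ind (topspace X) \<in> pointwise_topology X E closure_of B"
    using tight unfolding tightness_le_def by blast
  from B(1,2) obtain \<C> where C: "\<C> \<subseteq> \<S>" "|\<C>| \<le>o \<kappa>" "B = ind ` \<C>"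
    by (rule subset_image_card_ordLeq)
  have "\<forall>Z\<in>\<C>. \<exists>\<F>. finite \<F> \<and> \<F> \<subseteq> \<U> \<and> (\<Pi>\<^sub>E i\<in>{..<n}. Z) \<subseteq> \<Union>\<F>"
    using C(1) unfolding \<S>_def by blast
  then obtain \<F> where
    "\<forall>Z\<in>\<C>. finite (\<F> Z) \<and> \<F> Z \<subseteq> \<U> \<and> (\<Pi>\<^sub>E i\<in>{..<n}. Z) \<subseteq> \<Union>(\<F> Z)"
    by (rule bchoice[THEN exE])
  then have F: "\<And>Z. Z \<in> \<C> \<Longrightarrow> finite (\<F> Z)"
      "\<And>Z. Z \<in> \<C> \<Longrightarrow> \<F> Z \<subseteq> \<U>" "\<And>Z. Z \<in> \<C> \<Longrightarrow> (\<Pi>\<^sub>E i\<in>{..<n}. Z) \<subseteq> \<Union>(\<F> Z)"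
    by simp_all
  have "|\<Union>Z\<in>\<C>. \<F> Z| \<le>o \<kappa>"
  proof (rule card_of_UNION_ordLeq_infinite_Field)
    show "infinite (Field \<kappa>)" "Card_order \<kappa>"
      using \<kappa> by (auto simp: cinfinite_def)
    show "\<forall>Z\<in>\<C>. |\<F> Z| \<le>o \<kappa>"
      using F(1) finite_card_of_ordLeq_Cinfinite[OF \<kappa>] by blast
  qed (rule C(2))
  moreover have "\<Union>(\<Union>Z\<in>\<C>. \<F> Z) = topspace ?Yn"
  proof
    show "\<Union>(\<Union>Z\<in>\<C>. \<F> Z) \<subseteq> topspace ?Yn"
      using F(2) un by blast
    show "topspace ?Yn \<subseteq> \<Union>(\<Union>Z\<in>\<C>. \<F> Z)"
    proof
      fix p
      assume p: "p \<in> topspace ?Yn"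
      have pX: "p ` {..<n} \<subseteq> topspace X"
        using p by (auto simp: PiE_iff)
      have BE: "B \<subseteq> E"
        using B(1) SE by (rule subset_trans)
      have "\<exists>g\<in>B. \<forall>x\<in>p ` {..<n}. \<bar>g x - ind (topspace X) x\<bar> < 1"
        using B(3)[unfolded cl[OF BE], rule_format, of "p ` {..<n}" 1] pX by simp
      then obtain Z where Z: "Z \<in> \<C>" "\<forall>x\<in>p ` {..<n}. \<bar>ind Z x - ind (topspace X) x\<bar> < 1"
        unfolding C(3) by blast
      have "p i \<in> Z" if "i < n" for i
      proof -
        have "p i \<in> topspace X" "\<bar>ind Z (p i) - ind (topspace X) (p i)\<bar> < 1"
          using that pX Z(2) by auto
        then show ?thesis
          by (simp add: ind split: if_splits)
      qed
      then have "p \<in> (\<Pi>\<^sub>E i\<in>{..<n}. Z)"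
        using p by (auto simp: PiE_iff)
      then show "p \<in> \<Union>(\<Union>Z\<in>\<C>. \<F> Z)"
        using F(3)[OF Z(1)] Z(1) by (meson UN_I UnionE UnionI subsetD)
    qed
  qed
  moreover have "(\<Union>Z\<in>\<C>. \<F> Z) \<subseteq> \<U>"
    using F(2) by blast
  ultimately show "\<exists>\<V>. \<V> \<subseteq> \<U> \<and> |\<V>| \<le>o \<kappa> \<and> \<Union>\<V> = topspace ?Yn"
    by blast
qed

section \<open>Bounding the tightness by the Lindeloef number of the powers\<close>

text \<open>This half holds for continuous functions on any space: continuity makes the sets \<open>S n g\<close> below
  open, and countably many subcovers have total size at most \<open>\<kappa>\<close> because \<open>\<kappa>\<close> is infinite.\<close>

lemma tightness_le_if_lindelof_le_power:
  assumes \<kappa>: "Cinfinite \<kappa>" and lind: "\<And>n. n \<ge> 1 \<Longrightarrow> lindelof_le (finite_power Y n) \<kappa>"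
    and E: "E \<subseteq> cont_funs Y"
  shows "tightness_le (pointwise_topology Y E) \<kappa>"
  unfolding tightness_le_def
proof (intro allI impI, elim conjE)
  fix A f
  assume A: "A \<subseteq> topspace (pointwise_topology Y E)" and f: "f \<in> pointwise_topology Y E closure_of A"
  have AE: "A \<subseteq> E"
    using A by auto
  have fE: "f \<in> E"
    using f closure_of_subset_topspace by fastforce
  have Eext: "E \<subseteq> extensional (topspace Y)" and Econt: "\<And>g. g \<in> E \<Longrightarrow> continuous_map Y euclideanreal g"
    using E by (auto simp: cont_funs_def)
  note cl = in_closure_of_pointwise_topology[OF Eext _ fE]
  have approx: "\<exists>g\<in>A. \<forall>x\<in>K. \<bar>g x - f x\<bar> < \<epsilon>"
    if "finite K" "K \<subseteq> topspace Y" "0 < \<epsilon>" for K \<epsilon>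
    using f[unfolded cl[OF AE]] that by blast
  define S where "S n g = (\<Pi>\<^sub>E i\<in>{..<n}. {y \<in> topspace Y. \<bar>g y - f y\<bar> < 1 / real n})" for n :: nat and g
  have "\<exists>C. C \<subseteq> A \<and> |C| \<le>o \<kappa> \<and> \<Union>(S n ` C) = topspace (finite_power Y n)" if n: "n \<ge> 1" for n
  proof -
    have "openin (finite_power Y n) U" if "U \<in> S n ` A" for U
    proof -
      from that obtain g where g: "g \<in> A" and U: "U = S n g"
        by blast
      have "continuous_map Y euclideanreal (\<lambda>y. \<bar>g y - f y\<bar>)"
        using Econt g AE fE by (intro continuous_map_real_abs continuous_map_diff) auto
      then have "openin Y {y \<in> topspace Y. \<bar>g y - f y\<bar> \<in> {..<1 / real n}}"
        by (rule openin_continuous_map_preimage) auto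
      then show ?thesis
        unfolding U S_def by (intro iffD2[OF openin_PiE]) auto
    qed
    moreover have "\<Union>(S n ` A) = topspace (finite_power Y n)"
    proof
      show "\<Union>(S n ` A) \<subseteq> topspace (finite_power Y n)"
        by (auto simp: S_def PiE_iff)
      show "topspace (finite_power Y n) \<subseteq> \<Union>(S n ` A)"
      proof
        fix p
        assume p: "p \<in> topspace (finite_power Y n)"
        then obtain g where "g \<in> A" "\<forall>x\<in>p ` {..<n}. \<bar>g x - f x\<bar> < 1 / real n"
          using approx[of "p ` {..<n}" "1 / real n"] n by (auto simp: PiE_iff)
        then show "p \<in> \<Union>(S n ` A)"
          using p by (auto simp: S_def PiE_iff)
      qed
    qed
    ultimately have "\<exists>\<V>\<subseteq>S n ` A. |\<V>| \<le>o \<kappa> \<and> \<Union>\<V> = topspace (finite_power Y n)"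
      using lind[OF n, unfolded lindelof_le_def, rule_format, of "S n ` A"] by simp
    then obtain \<V> where V: "\<V> \<subseteq> S n ` A" "|\<V>| \<le>o \<kappa>" "\<Union>\<V> = topspace (finite_power Y n)"
      by (elim exE conjE) (rule that)
    from V(1,2) obtain C where "C \<subseteq> A" "|C| \<le>o \<kappa>" "\<V> = S n ` C"
      by (rule subset_image_card_ordLeq)
    with V(3) show ?thesis
      by blast
  qed
  then obtain C where C: "\<And>n. n \<ge> 1 \<Longrightarrow> C n \<subseteq> A" "\<And>n. n \<ge> 1 \<Longrightarrow> |C n| \<le>o \<kappa>"
      "\<And>n. n \<ge> 1 \<Longrightarrow> \<Union>(S n ` C n) = topspace (finite_power Y n)"
    by metis
  obtain a where a: "a \<in> A"
    using approx[of "{}" 1] by auto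
  \<comment> \<open>The index \<open>0\<close> is used to make \<open>B\<close> nonempty. Over the empty space all \<open>C n\<close> with \<open>n \<ge> 1\<close> may be
    empty, whereas \<open>f\<close> is in the closure only of nonempty sets.\<close>
  define B where "B = (\<Union>n. if n = 0 then {a} else C n)"
  have \<kappa>': "infinite (Field \<kappa>)" "Card_order \<kappa>"
    using \<kappa> by (auto simp: cinfinite_def)
  have "|B| \<le>o \<kappa>"
    unfolding B_def
  proof (rule card_of_UNION_ordLeq_infinite_Field[OF \<kappa>'])
    show "|UNIV :: nat set| \<le>o \<kappa>"
      by (rule ordIso_ordLeq_trans[OF card_of_nat natLeq_ordLeq_cinfinite[OF \<kappa>]])
    have "|{a}| \<le>o \<kappa>"
      by (intro finite_card_of_ordLeq_Cinfinite[OF \<kappa>]) simp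
    then show "\<forall>n\<in>UNIV. |if n = 0 then {a} else C n| \<le>o \<kappa>"
      using C(2) by auto
  qed
  moreover have BA: "B \<subseteq> A"
    unfolding B_def using a C(1) by (intro UN_least) simp
  moreover have "f \<in> pointwise_topology Y E closure_of B"
    unfolding cl[OF subset_trans[OF BA AE]]
  proof (intro allI impI, elim conjE)
    fix K and \<epsilon> :: real
    assume K: "finite K" "K \<subseteq> topspace Y" and "0 < \<epsilon>"
    show "\<exists>g\<in>B. \<forall>x\<in>K. \<bar>g x - f x\<bar> < \<epsilon>"
    proof (cases "K = {}")
      case True
      have "a \<in> B"
        unfolding B_def by (rule UN_I[of 0]) simp_all
      with True show ?thesis
        by blast
    next
      case False
      then obtain k where k: "k \<in> K"
        by blast
      obtain xs where xs: "set xs = K"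
        using K(1) finite_list by blast
      obtain m where m: "1 / real (Suc m) < \<epsilon>"
        using nat_approx_posE[OF \<open>0 < \<epsilon>\<close>] by metis
      define n where "n = max (length xs) (Suc m)"
      have n: "n \<ge> 1" "length xs \<le> n" "1 / real n < \<epsilon>"
      proof -
        have "1 / real n \<le> 1 / real (Suc m)"
          by (intro divide_left_mono) (auto simp: n_def)
        then show "1 / real n < \<epsilon>"
          using m by linarith
      qed (auto simp: n_def)
      \<comment> \<open>A point of the \<open>n\<close>-th power that lists \<open>K\<close>, padded by repeating \<open>k\<close>.\<close>
      define p where "p = (\<lambda>i\<in>{..<n}. if i < length xs then xs ! i else k)"
      have "p \<in> topspace (finite_power Y n)"
        using K(2) k xs nth_mem by (fastforce simp: p_def PiE_iff)
      then obtain g where g: "g \<in> C n" "p \<in> S n g"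
        using C(3)[OF n(1)] by blast
      have "\<bar>g x - f x\<bar> < \<epsilon>" if x: "x \<in> K" for x
      proof -
        obtain i where i: "i < length xs" "xs ! i = x"
          using x xs by (metis in_set_conv_nth)
        then have "\<bar>g x - f x\<bar> < 1 / real n"
          using g(2) n(2) by (auto simp: S_def PiE_iff p_def dest!: bspec[of _ _ i])
        then show ?thesis
          using n(3) by linarith
      qed
      moreover have "g \<in> B"
        using g(1) n(1) by (auto simp: B_def intro!: exI[of _ n])
      ultimately show ?thesis
        by blast
    qed
  qed
  ultimately show "\<exists>B\<subseteq>A. |B| \<le>o \<kappa> \<and> f \<in> pointwise_topology Y E closure_of B"
    by blast
qed

section \<open>The tightness of function spaces over the Baire topology\<close>

text \<open>The two cardinals are given on different types; each of the two bounds above, applied with the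
  cardinal of the other side as \<open>\<kappa>\<close>, gives one inequality.\<close>

theorem theorem2p2:
  fixes X :: "'a topology" and E :: "('a \<Rightarrow> real) set"
  assumes "completely_regular_space X" and "Hausdorff_space X"
    and "zero_set_combinations X \<subseteq> E" and "E \<subseteq> cont_funs (baire_topology X)"
  shows "tightness (pointwise_topology X E) =o lindelof_star (baire_topology X)"
proof -
  let ?t = "tightness (pointwise_topology X E)" and ?l = "lindelof_star (baire_topology X)"
  have E: "E \<subseteq> extensional (topspace X)"
    using assms(4) by (auto simp: cont_funs_def)
  note t = Cinfinite_tightness[of "pointwise_topology X E"]
  note l = Cinfinite_lindelof_star[of "baire_topology X"]
  have "tightness_le (pointwise_topology X E) ?t"
    using tightness_ordLeq_iff[OF t, of "pointwise_topology X E"] ordLeq_refl t by blast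
  then have "?l \<le>o ?t"
    unfolding lindelof_star_ordLeq_iff[OF t] lindelof_number_ordLeq_iff[OF t]
    using lindelof_le_power_if_tightness_le[OF t _ assms(3) E] by blast
  moreover have "\<And>n. n \<ge> 1 \<Longrightarrow> lindelof_le (finite_power (baire_topology X) n) ?l"
    using lindelof_star_ordLeq_iff[OF l, of "baire_topology X"] lindelof_number_ordLeq_iff[OF l] ordLeq_refl l
    by blast
  then have "?t \<le>o ?l"
    unfolding tightness_ordLeq_iff[OF l]
    using tightness_le_if_lindelof_le_power[OF l _ assms(4)] by simp
  ultimately show ?thesis
    by (simp add: ordIso_iff_ordLeq)
qed

end
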